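(* Let $p$ be prime, let $n \geq 2$ be an integer, and let $m < n$. Let $L: \mathbb{F}_p^n \to \mathbb{F}_p^m$ be an $\mathbb{F}_p$-linear map of rank $m$. Let $S$ be a minimal element (with respect to inclusion) of $\mathsf{suppker}(L)$. Let $S'$ be a maximal (with respect to inclusion) subset of $[n] \setminus S$ such that $2^{S' \cup S} \cap \mathsf{suppker}(L) = \{ S \}$. Let $k_1, \ldots, k_n$ be integers with $1 \leq k_i \leq p$ for each $i$. Let $k_{\max} = \max_{i\in S} k_i$ and $k_{\min} = \min_{i \in S} k_i$, and suppose $p \geq k_{\max} + k_{\min} - 1$. Define $$\lambda = \left(\prod_{i\in S} k_i - \prod_{i\in S} (k_i-1) \right) \cdot \prod_{i \in S'} k_i .$$ Then for all $A_1, \ldots, A_n \subseteq \mathbb{F}_p$ with $|A_i| = k_i$ for each $i$, we have $$ | L(A_1, \ldots, A_n)| \geq \lambda.$$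
   Context: $\mathbb{F}_p$ is the field of integers modulo $p$, $[n] = \{1,\ldots,n\}$, and $2^{T}$ denotes the set of all subsets of $T$. For $v \in \mathbb{F}_p^n$, $\mathrm{supp}(v) = \{ i \in [n] \mid v_i \neq 0\}$. For a linear map $L: \mathbb{F}_p^n \to \mathbb{F}_p^m$, its support-kernel is $\mathsf{suppker}(L) = \{ S \subseteq [n] \mid \exists v \in \ker(L),\ v \neq 0,\ \mathrm{supp}(v) = S\}$. For subsets $A_1,\ldots,A_n \subseteq \mathbb{F}_p$, $L(A_1, \ldots, A_n) = \{ L(a_1, \ldots, a_n) \mid a_i \in A_i \text{ for each } i \}$. Empty products equal $1$. *)

theory Defs
  imports "Berlekamp_Zassenhaus.Finite_Field" "Jordan_Normal_Form.VS_Connect"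
begin

text \<open>
  The field of integers modulo a prime \<open>p = CARD('p)\<close> is \<open>'p mod_ring\<close> with \<open>'p :: prime_card\<close>.
  The space of column vectors of length \<open>n\<close> is \<open>module_vec TYPE('p mod_ring) n\<close>, with carrier
  \<open>carrier_vec n\<close>; coordinates are numbered from \<open>0\<close>, so \<open>{0..<n}\<close> plays the role of
  \<open>{1,...,n}\<close>.
\<close>

definition vec_supp :: "'a :: zero vec \<Rightarrow> nat set" where
  "vec_supp v = {i \<in> {0..<dim_vec v}. v $ i \<noteq> 0}"

definition linear_vec_map :: "nat \<Rightarrow> nat \<Rightarrow> ('a :: field vec \<Rightarrow> 'a vec) \<Rightarrow> bool" where
  "linear_vec_map n m L \<longleftrightarrow>
     linear_map class_ring (module_vec TYPE('a) n) (module_vec TYPE('a) m) L"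

definition vec_map_ker :: "nat \<Rightarrow> nat \<Rightarrow> ('a :: field vec \<Rightarrow> 'a vec) \<Rightarrow> 'a vec set" where
  "vec_map_ker n m L = mod_hom.ker (module_vec TYPE('a) n) (module_vec TYPE('a) m) L"

definition vec_map_rank :: "nat \<Rightarrow> nat \<Rightarrow> ('a :: field vec \<Rightarrow> 'a vec) \<Rightarrow> nat" where
  "vec_map_rank n m L = vectorspace.dim class_ring
     (module_vec TYPE('a) m \<lparr>carrier := mod_hom.im (module_vec TYPE('a) n) L\<rparr>)"

definition suppker :: "nat \<Rightarrow> nat \<Rightarrow> ('a :: field vec \<Rightarrow> 'a vec) \<Rightarrow> nat set set" where
  "suppker n m L =
     {S. S \<subseteq> {0..<n} \<and> (\<exists>v \<in> vec_map_ker n m L. v \<noteq> 0\<^sub>v n \<and> vec_supp v = S)}"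

definition vec_map_image ::
  "nat \<Rightarrow> ('a vec \<Rightarrow> 'a vec) \<Rightarrow> (nat \<Rightarrow> 'a set) \<Rightarrow> 'a vec set" where
  "vec_map_image n L A = {L a | a. a \<in> carrier_vec n \<and> (\<forall>i<n. a $ i \<in> A i)}"

end

theory Submission
  imports Defs "Berlekamp_Zassenhaus.Berlekamp_Type_Based"
begin

text \<open>
  Vary only the coordinates in \<open>S' \<union> S\<close> and keep every other coordinate at a fixed value.
  By hypothesis the only support of a nonzero kernel vector inside \<open>S' \<union> S\<close> is \<open>S\<close>, and this makes
  those kernel vectors the multiples of a single vector \<open>v\<close> with support \<open>S\<close>: subtracting from
  one of them the multiple of \<open>v\<close> that cancels a coordinate in \<open>S\<close> leaves a kernel vector whose
  support is not \<open>S\<close>, hence zero (\<open>ker_vec_eq_smult\<close>). So two of the remaining inputs have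
  the same image exactly when they agree on \<open>S'\<close> and differ on \<open>S\<close> by a multiple of \<open>v\<close>.
  The number of images is therefore \<open>\<Prod>i\<in>S'. k\<^sub>i\<close> times the number of lines in direction \<open>v\<close> that
  meet the box over \<open>S\<close>. Dividing coordinate \<open>i\<close> by \<open>v\<^sub>i\<close> turns the direction into \<open>(1,...,1)\<close>.

  It remains to see that at least \<open>\<Prod>k\<^sub>i - \<Prod>(k\<^sub>i - 1)\<close> diagonal lines meet a box with sides of sizes
  \<open>k\<^sub>i\<close> (\<open>diag_lines_box\<close>). Add the coordinates one at a time, starting with one of minimal size.
  A line that meets the old box in the points with parameters \<open>T\<close> splits, after a factor \<open>C\<close> is added,
  into one line for each element of \<open>C - T\<close>; by the Cauchy-Davenport inequality these are at least
  \<open>|C| + |T| - 1\<close> many. Since the sets \<open>T\<close> partition the old box, summing over the \<open>N\<close> old lines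
  gives at least \<open>(|C| - 1) N + P\<close> new lines, where \<open>P\<close> is the product of the old
  sizes \<open>k\<^sub>i\<close>. Inserting the induction hypothesis \<open>N \<ge> P - Q\<close>, where \<open>Q\<close> is the product of the
  old \<open>k\<^sub>i - 1\<close>, yields \<open>|C| P - (|C| - 1) Q\<close>, which is the claim for the new box. Each \<open>T\<close> is at most
  as large as the first factor, so \<open>|C| + |T| - 1 \<le> p\<close> follows from the hypothesis on
  \<open>k\<^sub>m\<^sub>a\<^sub>x + k\<^sub>m\<^sub>i\<^sub>n\<close>.
\<close>

section \<open>The Cauchy-Davenport inequality\<close>

text \<open>Every element of the prime field is a natural multiple of \<open>d\<close>, so the orbit of a single point
  under the shift by \<open>d\<close> is everything.\<close>
lemma shift_closed_eq_UNIV: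
  fixes A :: "'p :: prime_card mod_ring set"
  assumes "A \<noteq> {}" and "d \<noteq> 0" and closed: "\<And>a. a \<in> A \<Longrightarrow> a + d \<in> A"
  shows "A = UNIV"
proof -
  obtain a where a: "a \<in> A" using assms(1) by auto
  have mult: "a + of_nat k * d \<in> A" for k :: nat
  proof (induction k)
    case (Suc k)
    show ?case using closed[OF Suc] by (simp add: algebra_simps)
  qed (use a in simp)
  have "x \<in> A" for x
  proof -
    obtain k where "(x - a) / d = of_nat k" using surj_of_nat_mod_ring[of "(x - a) / d"] by auto
    then have "x = a + of_nat k * d" using \<open>d \<noteq> 0\<close> by (simp add: field_simps)
    then show ?thesis using mult by simp
  qed
  then show ?thesis by auto
qed

definition sumset :: "'a :: plus set \<Rightarrow> 'a set \<Rightarrow> 'a set" where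
  "sumset A B = {a + b | a b. a \<in> A \<and> b \<in> B}"

text \<open>Dyson's transform: a translate \<open>C = B + e\<close> that meets \<open>A\<close> without being contained in it lets
  one replace \<open>A\<close> by \<open>A \<union> C\<close> and \<open>B\<close> by the part of \<open>B\<close> that \<open>e\<close> moves into \<open>A\<close>. The sum of
  the two sizes is unchanged, the sumset does not grow, and the second set shrinks.\<close>
lemma cauchy_davenport:
  fixes A B :: "'p :: prime_card mod_ring set"
  assumes "A \<noteq> {}" and "B \<noteq> {}"
  shows "min CARD('p) (card A + card B - 1) \<le> card (sumset A B)"
  using assms
proof (induction "card B" arbitrary: A B rule: less_induct)
  case less
  have card_UNIV: "CARD('p mod_ring) = CARD('p)" by simp
  have fin: "finite X" for X :: "'p mod_ring set" by simp
  have translate: "card ((\<lambda>a. a + b) ` A) = card A" for b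
    by (intro card_image) (auto simp: inj_on_def)
  have ge_A: "card A \<le> card (sumset A B)"
  proof -
    obtain b where "b \<in> B" using less.prems by auto
    then have "(\<lambda>a. a + b) ` A \<subseteq> sumset A B" by (auto simp: sumset_def)
    then show ?thesis using translate[of b] card_mono[OF fin] by metis
  qed
  consider (univ) "A = UNIV" | (single) "card B = 1" | (large) "A \<noteq> UNIV" "card B \<noteq> 1" by blast
  then show ?case
  proof cases
    case univ
    then show ?thesis using ge_A card_UNIV by simp
  next
    case single
    then show ?thesis using ge_A by simp
  next
    case large
    then have "\<not> is_singleton B" by (simp add: is_singleton_altdef)
    then obtain b b' where b: "b \<in> B" "b' \<in> B" "b \<noteq> b'"
      using less.prems by (metis is_singletonI')
    then obtain a where a: "a \<in> A" "a + (b' - b) \<notin> A"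
      using shift_closed_eq_UNIV[of A "b' - b"] large less.prems by auto
    \<comment> \<open>This shift moves \<open>b\<close> to \<open>a\<close>, inside \<open>A\<close>, and \<open>b'\<close> to \<open>a + (b' - b)\<close>, outside \<open>A\<close>.\<close>
    define e where "e = a - b"
    define C where "C = (\<lambda>x. x + e) ` B"
    define B' where "B' = {x \<in> B. x + e \<in> A}"
    have "b \<in> B'" using a b by (simp add: B'_def e_def)
    moreover have "b' \<notin> B'" using a b by (simp add: B'_def e_def algebra_simps)
    ultimately have B': "B' \<noteq> {}" "B' \<subset> B" using b by (auto simp: B'_def)
    then have smaller: "card B' < card B" by (intro psubset_card_mono fin)
    have cC: "card C = card B"
      unfolding C_def by (intro card_image) (auto simp: inj_on_def)
    have "(\<lambda>x. x + e) ` B' = A \<inter> C" by (auto simp: C_def B'_def)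
    moreover have "card ((\<lambda>x. x + e) ` B') = card B'"
      by (intro card_image) (auto simp: inj_on_def)
    ultimately have cB': "card (A \<inter> C) = card B'" by simp
    have size: "card (A \<union> C) + card B' = card A + card B"
      using card_Un_Int[OF fin fin, of A C] cB' cC by simp
    have "x + y \<in> sumset A B" if "x \<in> A \<union> C" "y \<in> B'" for x y
      using that(1)
    proof
      assume "x \<in> A"
      then show ?thesis using that by (auto simp: B'_def sumset_def)
    next
      assume "x \<in> C"
      then obtain z where "z \<in> B" "x = z + e" by (auto simp: C_def)
      then have "x + y = (y + e) + z" "y + e \<in> A" using that by (auto simp: B'_def)
      then show ?thesis using \<open>z \<in> B\<close> unfolding sumset_def by blast
    qed
    then have "sumset (A \<union> C) B' \<subseteq> sumset A B" by (auto simp: sumset_def)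
    then have "card (sumset (A \<union> C) B') \<le> card (sumset A B)" by (intro card_mono fin)
    moreover have "min CARD('p) (card (A \<union> C) + card B' - 1) \<le> card (sumset (A \<union> C) B')"
      using less.hyps[OF smaller, of "A \<union> C"] B' less.prems by auto
    ultimately show ?thesis using size by simp
  qed
qed

section \<open>Diagonal lines meeting a box\<close>

text \<open>When \<open>r \<in> I\<close>, two points have the same value if and only if they differ on \<open>I\<close> by a constant.
  Hence the values label the lines in direction \<open>(1,...,1)\<close>.\<close>
definition diag_proj :: "'i \<Rightarrow> 'i set \<Rightarrow> ('i \<Rightarrow> 'a :: minus) \<Rightarrow> 'i \<Rightarrow> 'a" where
  "diag_proj r I x = (\<lambda>i\<in>I. x i - x r)"

text \<open>The reference coordinate \<open>r\<close> is the first factor of the box. Every diagonal line meets the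
  box in at most \<open>card (A r)\<close> points, because its points differ in the coordinate \<open>r\<close>; this bound and
  the last hypothesis keep the Cauchy-Davenport bound for a fibre at most \<open>p\<close>.\<close>
lemma diag_lines_box:
  fixes A :: "'i \<Rightarrow> 'p :: prime_card mod_ring set"
  assumes "finite J" and "r \<notin> J"
    and "\<And>i. i \<in> insert r J \<Longrightarrow> A i \<noteq> {}"
    and "\<And>i. i \<in> J \<Longrightarrow> card (A i) + card (A r) - 1 \<le> CARD('p)"
  shows "(\<Prod>i\<in>insert r J. int (card (A i))) - (\<Prod>i\<in>insert r J. int (card (A i)) - 1)
      \<le> int (card (diag_proj r (insert r J) ` PiE (insert r J) A))"
  using assms
proof (induction J rule: finite_induct)
  case empty
  have "finite (diag_proj r {r} ` PiE {r} A)"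
    by (intro finite_imageI finite_PiE) auto
  moreover have "PiE {r} A \<noteq> {}" using empty.prems by (simp add: PiE_eq_empty_iff)
  ultimately have "card (diag_proj r {r} ` PiE {r} A) \<noteq> 0"
    by (simp only: card_eq_0_iff image_is_empty simp_thms)
  then show ?case by simp
next
  case (insert j J)
  define I where "I = insert r J"
  define X where "X = PiE I A"
  define Y where "Y = diag_proj r I ` X"
  define T where "T y = (\<lambda>x. x r) ` {x \<in> X. diag_proj r I x = y}" for y
  \<comment> \<open>While \<open>T y\<close> parametrises the points of the box on the line \<open>y\<close>, the difference set
    \<open>D y = A j - T y\<close> consists of the entries at \<open>j\<close> that extend the label \<open>y\<close>.\<close>
  define D where "D y = sumset (A j) (uminus ` T y)" for y
  have I: "finite I" "r \<in> I" "j \<notin> I" "j \<noteq> r"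
    using insert by (auto simp: I_def)
  have finX: "finite X" unfolding X_def using I by (intro finite_PiE) auto
  then have finY: "finite Y" by (simp add: Y_def)
  have inj: "inj_on (\<lambda>x. x r) {x \<in> X. diag_proj r I x = y}" for y
  proof (rule inj_onI)
    fix x x' assume x: "x \<in> {x \<in> X. diag_proj r I x = y}"
      and x': "x' \<in> {x \<in> X. diag_proj r I x = y}" and eq: "x r = x' r"
    show "x = x'"
    proof
      fix i
      have "diag_proj r I x = diag_proj r I x'" using x x' by simp
      then have "diag_proj r I x i = diag_proj r I x' i" by (rule fun_cong)
      moreover have "x \<in> PiE I A" "x' \<in> PiE I A" using x x' by (simp_all add: X_def)
      ultimately show "x i = x' i"
        using eq PiE_arb[of x I A i] PiE_arb[of x' I A i]
        by (cases "i \<in> I") (simp_all add: diag_proj_def)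
    qed
  qed
  have "card X = (\<Sum>y\<in>Y. card {x \<in> X. diag_proj r I x = y})"
    unfolding Y_def using sum.image_gen[OF finX, of "\<lambda>_. 1::nat" "diag_proj r I"] by simp
  then have "card X = (\<Sum>y\<in>Y. card (T y))"
    using inj by (simp add: T_def card_image)
  then have sumT: "int (card X) = (\<Sum>y\<in>Y. int (card (T y)))" by simp
  have image: "diag_proj r (insert j I) ` PiE (insert j I) A = (\<lambda>(y, d). y(j := d)) ` Sigma Y D"
  proof (intro equalityI subsetI)
    fix w assume "w \<in> diag_proj r (insert j I) ` PiE (insert j I) A"
    then obtain x where x: "x \<in> PiE (insert j I) A" "w = diag_proj r (insert j I) x" by auto
    define x' where "x' = restrict x I"
    have x': "x' \<in> X" using x by (auto simp: x'_def X_def)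
    have "w = (diag_proj r I x')(j := x j - x r)"
      using I x by (auto simp: diag_proj_def x'_def fun_eq_iff)
    moreover have "x r \<in> T (diag_proj r I x')"
      unfolding T_def using x' I by (intro image_eqI[of _ _ x']) (auto simp: x'_def)
    then have "x j + - x r \<in> D (diag_proj r I x')"
      using x unfolding D_def sumset_def by blast
    ultimately show "w \<in> (\<lambda>(y, d). y(j := d)) ` Sigma Y D"
      using x' by (force simp: Y_def)
  next
    fix w assume "w \<in> (\<lambda>(y, d). y(j := d)) ` Sigma Y D"
    then obtain a x where *: "a \<in> A j" "x \<in> X" "w = (diag_proj r I x)(j := a - x r)"
      by (auto simp: D_def sumset_def T_def)
    then have "w = diag_proj r (insert j I) (x(j := a))"
      using I by (auto simp: diag_proj_def fun_eq_iff)
    moreover have "x(j := a) \<in> PiE (insert j I) A"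
      using * unfolding X_def by (intro PiE_fun_upd) auto
    ultimately show "w \<in> diag_proj r (insert j I) ` PiE (insert j I) A" by blast
  qed
  have "inj_on (\<lambda>(y, d). y(j := d)) (Sigma Y D)"
  proof (rule inj_onI, clarify)
    fix y d y' d' assume Y: "y \<in> Y" "y' \<in> Y" and eq: "y(j := d) = y'(j := d')"
    have "y j = undefined" "y' j = undefined"
      using Y I by (auto simp: Y_def diag_proj_def)
    then have "y i = y' i" for i using fun_cong[OF eq, of i] by (cases "i = j") auto
    moreover have "d = d'" using fun_cong[OF eq, of j] by simp
    ultimately show "y = y' \<and> d = d'" by auto
  qed
  then have "card (diag_proj r (insert j I) ` PiE (insert j I) A) = card (Sigma Y D)"
    using image card_image by metis
  also have "\<dots> = (\<Sum>y\<in>Y. card (D y))" using finY by simp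
  finally have cardN: "card (diag_proj r (insert j I) ` PiE (insert j I) A) = (\<Sum>y\<in>Y. card (D y))" .
  have fibre: "int (card (A j)) - 1 + int (card (T y)) \<le> int (card (D y))" if "y \<in> Y" for y
  proof -
    have T: "T y \<noteq> {}" "T y \<subseteq> A r" using that I by (auto simp: T_def Y_def X_def)
    have cT: "card (uminus ` T y) = card (T y)" by (intro card_image) (auto simp: inj_on_def)
    have "card (T y) \<le> card (A r)" using T by (intro card_mono) auto
    moreover have "card (A j) + card (A r) - 1 \<le> CARD('p)" using insert.prems by simp
    ultimately have "card (A j) + card (T y) - 1 \<le> CARD('p)" by linarith
    moreover have "min CARD('p) (card (A j) + card (uminus ` T y) - 1) \<le> card (D y)"
      unfolding D_def using T insert.prems by (intro cauchy_davenport) auto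
    ultimately show ?thesis using cT by simp
  qed
  define P where "P = (\<Prod>i\<in>I. int (card (A i)))"
  define Q where "Q = (\<Prod>i\<in>I. int (card (A i)) - 1)"
  have "card X = (\<Prod>i\<in>I. card (A i))" unfolding X_def using I by (intro card_PiE)
  then have cX: "int (card X) = P" by (simp add: P_def)
  have IH: "P - Q \<le> int (card Y)"
    unfolding P_def Q_def Y_def X_def I_def
    by (rule insert.IH) (use insert.prems in auto)
  have "card (A j) > 0" using insert.prems by (simp add: card_gt_0_iff)
  then have "int (card (A j)) - 1 \<ge> 0" by linarith
  then have "(int (card (A j)) - 1) * (P - Q) \<le> (int (card (A j)) - 1) * int (card Y)"
    by (intro mult_left_mono IH)
  then have "int (card (A j)) * P - (int (card (A j)) - 1) * Q
      \<le> (int (card (A j)) - 1) * int (card Y) + P"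
    by (simp add: algebra_simps)
  also have "\<dots> = (\<Sum>y\<in>Y. int (card (A j)) - 1 + int (card (T y)))"
    using sumT cX by (subst sum.distrib) simp
  also have "\<dots> \<le> (\<Sum>y\<in>Y. int (card (D y)))" by (intro sum_mono fibre)
  finally have "int (card (A j)) * P - (int (card (A j)) - 1) * Q
      \<le> int (card (diag_proj r (insert j I) ` PiE (insert j I) A))"
    using cardN by simp
  moreover have "insert r (insert j J) = insert j I" by (auto simp: I_def)
  ultimately show ?case using I by (simp add: P_def Q_def)
qed

section \<open>Kernel vectors supported near a circuit\<close>

lemma linear_vec_map_props:
  fixes L :: "'a :: field vec \<Rightarrow> 'a vec"
  assumes "linear_vec_map n m L"
  shows linear_vec_map_carrier: "a \<in> carrier_vec n \<Longrightarrow> L a \<in> carrier_vec m"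
    and linear_vec_map_add: "a \<in> carrier_vec n \<Longrightarrow> b \<in> carrier_vec n \<Longrightarrow> L (a + b) = L a + L b"
    and linear_vec_map_smult: "a \<in> carrier_vec n \<Longrightarrow> L (c \<cdot>\<^sub>v a) = c \<cdot>\<^sub>v L a"
    and mem_vec_map_ker: "v \<in> vec_map_ker n m L \<longleftrightarrow> v \<in> carrier_vec n \<and> L v = 0\<^sub>v m"
proof -
  interpret linear_map class_ring "module_vec TYPE('a) n" "module_vec TYPE('a) m" L
    using assms by (simp add: linear_vec_map_def)
  show "a \<in> carrier_vec n \<Longrightarrow> L a \<in> carrier_vec m"
    using f_im[of a] by (simp add: module_vec_simps)
  show "a \<in> carrier_vec n \<Longrightarrow> b \<in> carrier_vec n \<Longrightarrow> L (a + b) = L a + L b"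
    using f_add[of a b] by (simp add: module_vec_simps)
  show "a \<in> carrier_vec n \<Longrightarrow> L (c \<cdot>\<^sub>v a) = c \<cdot>\<^sub>v L a"
    using f_smult[of c a] by (simp add: module_vec_simps class_ring_simps)
  show "v \<in> vec_map_ker n m L \<longleftrightarrow> v \<in> carrier_vec n \<and> L v = 0\<^sub>v m"
    by (simp add: vec_map_ker_def ker_def module_vec_simps)
qed

lemma linear_vec_map_diff_smult:
  fixes L :: "'a :: field vec \<Rightarrow> 'a vec"
  assumes "linear_vec_map n m L" and "a \<in> carrier_vec n" and "b \<in> carrier_vec n"
  shows "L (a - c \<cdot>\<^sub>v b) = L a - c \<cdot>\<^sub>v L b"
proof -
  have "a - c \<cdot>\<^sub>v b = a + (- c) \<cdot>\<^sub>v b" using assms by auto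
  then have "L (a - c \<cdot>\<^sub>v b) = L a + (- c) \<cdot>\<^sub>v L b"
    using assms by (simp add: linear_vec_map_add linear_vec_map_smult)
  also have "\<dots> = L a - c \<cdot>\<^sub>v L b"
    using linear_vec_map_carrier[OF assms(1)] assms(2,3)
    by (intro eq_vecI) (auto dest!: carrier_vecD)
  finally show ?thesis .
qed

text \<open>Since \<open>r\<close> lies in \<open>S\<close>, the vector \<open>v\<close> does not vanish there, and \<open>w - (w\<^sub>r / v\<^sub>r) v\<close> is a kernel
  vector supported in \<open>U\<close> that does vanish at \<open>r\<close>. Its support is thus not \<open>S\<close>, and it must be zero.\<close>
lemma ker_vec_eq_smult:
  fixes L :: "'a :: field vec \<Rightarrow> 'a vec"
  assumes lin: "linear_vec_map n m L"
    and only: "Pow U \<inter> suppker n m L = {S}"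
    and v: "v \<in> vec_map_ker n m L" "vec_supp v = S" and "r \<in> S"
    and w: "w \<in> vec_map_ker n m L" "vec_supp w \<subseteq> U"
  shows "w = (w $ r / v $ r) \<cdot>\<^sub>v v"
proof -
  define c where "c = w $ r / v $ r"
  define u where "u = w - c \<cdot>\<^sub>v v"
  have dims: "v \<in> carrier_vec n" "w \<in> carrier_vec n"
    using v w mem_vec_map_ker[OF lin] by auto
  have r: "r < n" "v $ r \<noteq> 0" using \<open>r \<in> S\<close> v dims by (auto simp: vec_supp_def)
  have ker: "u \<in> vec_map_ker n m L"
    using v w dims by (auto simp: mem_vec_map_ker[OF lin] u_def linear_vec_map_diff_smult[OF lin])
  have ur: "u $ r = 0" using r dims by (simp add: u_def c_def)
  have "S \<subseteq> U" using only by auto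
  have supp: "vec_supp u \<subseteq> U"
  proof
    fix i assume "i \<in> vec_supp u"
    then have "i < n" "w $ i - c * v $ i \<noteq> 0" using dims by (auto simp: vec_supp_def u_def)
    then have "i \<in> vec_supp v \<or> i \<in> vec_supp w" using dims by (auto simp: vec_supp_def)
    then show "i \<in> U" using \<open>S \<subseteq> U\<close> v w by auto
  qed
  have "u = 0\<^sub>v n"
  proof (rule ccontr)
    assume "u \<noteq> 0\<^sub>v n"
    moreover have "vec_supp u \<subseteq> {0..<n}" using dims by (auto simp: vec_supp_def u_def)
    ultimately have "vec_supp u \<in> Pow U \<inter> suppker n m L"
      using ker supp by (auto simp: suppker_def)
    then have "r \<in> vec_supp u" using only \<open>r \<in> S\<close> by auto
    then show False using ur by (simp add: vec_supp_def)
  qed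
  then have "(w - c \<cdot>\<^sub>v v) $ i = 0" if "i < n" for i using that by (simp add: u_def)
  then show ?thesis unfolding c_def[symmetric]
    using dims by (intro eq_vecI) auto
qed

section \<open>The bound for the image\<close>

lemma card_image_le_if_factors:
  assumes "finite X" and "\<And>x y. x \<in> X \<Longrightarrow> y \<in> X \<Longrightarrow> f x = f y \<Longrightarrow> g x = g y"
  shows "card (g ` X) \<le> card (f ` X)"
proof -
  have "g x = g (inv_into X f (f x))" if "x \<in> X" for x
    using that assms(2) by (metis f_inv_into_f imageI inv_into_into)
  then have "g ` X \<subseteq> (\<lambda>z. g (inv_into X f z)) ` f ` X" by blast
  then show ?thesis using assms(1) by (meson finite_imageI surj_card_le)
qed

theorem theorem2p2:
  fixes n m :: nat
    and L :: "'p :: prime_card mod_ring vec \<Rightarrow> 'p mod_ring vec"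
    and S S' :: "nat set"
    and k :: "nat \<Rightarrow> int"
    and lambda :: int
  assumes "n \<ge> 2"
    and "m < n"
    and "linear_vec_map n m L"
    and "vec_map_rank n m L = m"
    and "S \<in> suppker n m L"
    and "\<forall>T \<in> suppker n m L. T \<subseteq> S \<longrightarrow> T = S"
    and "S' \<subseteq> {0..<n} - S"
    and "Pow (S' \<union> S) \<inter> suppker n m L = {S}"
    and "\<forall>T. T \<subseteq> {0..<n} - S \<and> Pow (T \<union> S) \<inter> suppker n m L = {S} \<and> S' \<subseteq> T \<longrightarrow> T = S'"
    and "\<forall>i \<in> {0..<n}. 1 \<le> k i \<and> k i \<le> int CARD('p)"
    and "int CARD('p) \<ge> Max (k ` S) + Min (k ` S) - 1"
    and "lambda = ((\<Prod>i\<in>S. k i) - (\<Prod>i\<in>S. (k i - 1))) * (\<Prod>i\<in>S'. k i)"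
  shows "\<forall>A :: nat \<Rightarrow> 'p mod_ring set.
           (\<forall>i \<in> {0..<n}. int (card (A i)) = k i) \<longrightarrow>
           int (card (vec_map_image n L A)) \<ge> lambda"
proof (intro allI impI)
  fix A :: "nat \<Rightarrow> 'p mod_ring set"
  assume cardA: "\<forall>i\<in>{0..<n}. int (card (A i)) = k i"
  note lin = assms(3) and only = assms(8)
  obtain v where v: "v \<in> vec_map_ker n m L" "v \<noteq> 0\<^sub>v n" "vec_supp v = S" and Sn: "S \<subseteq> {0..<n}"
    using assms(5) by (auto simp: suppker_def)
  have vdim: "v \<in> carrier_vec n" using v mem_vec_map_ker[OF lin] by auto
  have vnz: "v $ i \<noteq> 0" if "i \<in> S" for i using that v by (auto simp: vec_supp_def)
  have "S \<noteq> {}"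
  proof
    assume "S = {}"
    then have "v = 0\<^sub>v n" using v vdim by (intro eq_vecI) (auto simp: vec_supp_def)
    then show False using v by simp
  qed
  have finS: "finite S" "finite S'" using Sn assms(7) by (auto intro: finite_subset[of _ "{0..<n}"])
  have S'n: "S' \<subseteq> {0..<n}" "S \<inter> S' = {}" using assms(7) by auto
  \<comment> \<open>With the smallest factor first, every partner fits: \<open>k i + k r - 1\<close> is at most
    \<open>Max (k ` S) + Min (k ` S) - 1\<close>.\<close>
  have "Min (k ` S) \<in> k ` S" using finS \<open>S \<noteq> {}\<close> by (intro Min_in) auto
  then obtain r where r: "r \<in> S" "k r = Min (k ` S)" by auto
  have pick: "\<exists>x. x \<in> A i" if "i < n" for i
  proof -
    have "int (card (A i)) \<ge> 1" using that cardA assms(10) by auto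
    then have "A i \<noteq> {}" by auto
    then show ?thesis by auto
  qed
  then obtain c where c: "\<And>i. i < n \<Longrightarrow> c i \<in> A i" by metis

  define A' where "A' i = (\<lambda>x. x / v $ i) ` A i" for i
  have cardA': "int (card (A' i)) = k i" if "i \<in> S" for i
  proof -
    have "card (A' i) = card (A i)"
      unfolding A'_def using vnz[OF that] by (intro card_image) (auto simp: inj_on_def)
    then show ?thesis using cardA Sn that by auto
  qed
  have room: "card (A' i) + card (A' r) - 1 \<le> CARD('p)" if "i \<in> S" for i
  proof -
    have "k i \<le> Max (k ` S)" using finS that by (intro Max_ge) auto
    then have "int (card (A' i)) + int (card (A' r)) - 1 \<le> int CARD('p)"
      using assms(11) r cardA'[OF that] cardA'[OF r(1)] by linarith
    then show ?thesis by linarith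
  qed
  have A'_ne: "A' i \<noteq> {}" if "i \<in> S" for i using pick Sn that by (force simp: A'_def)
  define N where "N = card (diag_proj r S ` PiE S A')"
  have "insert r (S - {r}) = S" using r by auto
  then have "(\<Prod>i\<in>S. int (card (A' i))) - (\<Prod>i\<in>S. int (card (A' i)) - 1) \<le> int N"
    using diag_lines_box[of "S - {r}" r A'] finS A'_ne room by (simp add: N_def)
  then have N: "(\<Prod>i\<in>S. k i) - (\<Prod>i\<in>S. k i - 1) \<le> int N" using cardA' by simp
  have prodS': "(\<Prod>i\<in>S'. k i) = int (card (PiE S' A))"
  proof -
    have "(\<Prod>i\<in>S'. k i) = (\<Prod>i\<in>S'. int (card (A i)))"
      using cardA S'n by (intro prod.cong) auto
    then show ?thesis using finS by (simp add: card_PiE)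
  qed
  have "(\<Prod>i\<in>S'. k i) \<ge> 0" unfolding prodS' by simp
  then have lam: "lambda \<le> int (N * card (PiE S' A))"
    unfolding assms(12) using N prodS' by (simp add: mult_right_mono)

  \<comment> \<open>\<open>B\<close> is the part of the box with all coordinates outside \<open>S' \<union> S\<close> equal to those of \<open>c\<close>. The map \<open>g\<close>
    records the line in direction \<open>v\<close> and the coordinates in \<open>S'\<close>; it takes at least \<open>lambda\<close> values on \<open>B\<close>, and
    it is determined by \<open>L\<close>.\<close>
  define B where "B = {a \<in> carrier_vec n. \<forall>i<n. a $ i \<in> A i \<and> (i \<notin> S' \<union> S \<longrightarrow> a $ i = c i)}"
  define g where "g a = (diag_proj r S (\<lambda>i. a $ i / v $ i), \<lambda>i\<in>S'. a $ i)" for a :: "'p mod_ring vec"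
  have finV: "finite X" if "X \<subseteq> carrier_vec n" for X :: "'p mod_ring vec set"
    using that finite_carrier_vec finite_subset by metis
  have finB: "finite B" by (intro finV) (auto simp: B_def)
  have "diag_proj r S ` PiE S A' \<times> PiE S' A \<subseteq> g ` B"
  proof (clarify)
    fix x z assume x: "x \<in> PiE S A'" and z: "z \<in> PiE S' A"
    define a where "a = vec n (\<lambda>i. if i \<in> S then v $ i * x i else if i \<in> S' then z i else c i)"
    have "v $ i * x i \<in> A i" if "i \<in> S" for i
    proof -
      have "x i \<in> A' i" using x that by auto
      then show ?thesis using vnz[OF that] by (auto simp: A'_def)
    qed
    then have "a \<in> B" using z c by (auto simp: B_def a_def)
    moreover have "a $ i / v $ i = x i" if "i \<in> S" for i
      using that Sn vnz[OF that] by (auto simp: a_def)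
    then have "diag_proj r S (\<lambda>i. a $ i / v $ i) = diag_proj r S x"
      using r(1) by (simp add: diag_proj_def cong: restrict_cong)
    moreover have "(\<lambda>i\<in>S'. a $ i) = z"
    proof
      fix i
      have "i < n \<and> i \<notin> S" if "i \<in> S'" using that S'n by auto
      then show "(\<lambda>i\<in>S'. a $ i) i = z i"
        using PiE_arb[OF z, of i] by (cases "i \<in> S'") (simp_all add: a_def)
    qed
    ultimately show "(diag_proj r S x, z) \<in> g ` B"
      by (intro image_eqI[of _ _ a]) (simp_all add: g_def)
  qed
  then have "card (diag_proj r S ` PiE S A' \<times> PiE S' A) \<le> card (g ` B)"
    using finB by (intro card_mono) auto
  then have NB: "N * card (PiE S' A) \<le> card (g ` B)" by (simp add: N_def card_cartesian_product)

  have factors: "g a = g b" if ab: "a \<in> B" "b \<in> B" "L a = L b" for a b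
  proof -
    define w where "w = a - b"
    have dims: "a \<in> carrier_vec n" "b \<in> carrier_vec n" using ab by (auto simp: B_def)
    have "w = a - 1 \<cdot>\<^sub>v b" by (simp add: w_def)
    then have "L w = L a - L b" using linear_vec_map_diff_smult[OF lin dims, of 1] by simp
    then have ker: "w \<in> vec_map_ker n m L"
      using ab dims linear_vec_map_carrier[OF lin dims(2)]
      by (simp add: mem_vec_map_ker[OF lin] w_def)
    have "vec_supp w \<subseteq> S' \<union> S"
    proof
      fix i assume "i \<in> vec_supp w"
      then have "i < n" "a $ i \<noteq> b $ i" using dims by (auto simp: vec_supp_def w_def)
      then show "i \<in> S' \<union> S" using ab(1,2) unfolding B_def by force
    qed
    then obtain t where t: "w = t \<cdot>\<^sub>v v"
      using ker_vec_eq_smult[OF lin only v(1,3) r(1) ker] by blast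
    have diff: "a $ i - b $ i = t * v $ i" if "i < n" for i
      using arg_cong[OF t, of "\<lambda>x. x $ i"] that dims vdim by (simp add: w_def)
    have "a $ i / v $ i = b $ i / v $ i + t" if "i \<in> S" for i
    proof -
      have "a $ i = b $ i + t * v $ i" using diff[of i] that Sn by (auto simp: algebra_simps)
      then show ?thesis using vnz[OF that] by (simp add: add_divide_distrib)
    qed
    then have "diag_proj r S (\<lambda>i. a $ i / v $ i) = diag_proj r S (\<lambda>i. b $ i / v $ i)"
      using r(1) by (simp add: diag_proj_def cong: restrict_cong)
    moreover have "(\<lambda>i\<in>S'. a $ i) = (\<lambda>i\<in>S'. b $ i)"
    proof (rule restrict_ext)
      fix i assume "i \<in> S'"
      then have "i < n" "i \<notin> vec_supp v" using S'n v by auto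
      then show "a $ i = b $ i" using diff[of i] vdim by (auto simp: vec_supp_def)
    qed
    ultimately show ?thesis by (simp only: g_def)
  qed
  have "card (g ` B) \<le> card (L ` B)" by (rule card_image_le_if_factors[OF finB factors])
  also have "\<dots> \<le> card (vec_map_image n L A)"
  proof (rule card_mono)
    have "vec_map_image n L A = L ` {a \<in> carrier_vec n. \<forall>i<n. a $ i \<in> A i}"
      unfolding vec_map_image_def by blast
    then show "finite (vec_map_image n L A)" by (simp add: finV)
    show "L ` B \<subseteq> vec_map_image n L A" unfolding vec_map_image_def B_def by blast
  qed
  finally show "lambda \<le> int (card (vec_map_image n L A))" using NB lam by linarith
qed

end
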